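(* Fix integers $d\ge1$ and $n\ge2$. Let $\varepsilon_1,\dots,\varepsilon_n$ be independent and identically distributed centered sub-Gaussian random variables with parameter $1$. Let $\psi:\mathbb R_+\to\mathbb R_+$ be a strictly increasing continuous function with inverse $\psi^{-1}$. Let $$Z=\max_{1\le n_1<n_2\le n}\frac{\big|\sum_{i=n_1+1}^{n_2}(i-n_1)^d\varepsilon_i\big|}{(n_2-n_1)^d\,\big(\min\{n_2,n-n_1\}\big)^{1/2}}.$$ Then, provided that $$\int_1^\infty e^{-c_0(\psi^{-1}(t))^2}\,dt<\infty$$ for some sufficiently small $c_0=c_0(d)$, there exist some $C_1=C_1(\psi,d)>0$ and $C_2=C_2(d)>0$ such that $$\mathbb E\,\psi(Z)\le C_1\Big[\psi\big((C_2\log\log(16n))^{1/2}\big)\vee1\Big].$$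
   Context: $a\vee b=\max\{a,b\}$. A centered random variable $X$ is called sub-Gaussian with parameter $\tau$ if there exists some $K>0$ such that $\mathbb E e^{\lambda X}\le Ke^{\lambda^2\tau^2/2}$ for all $\lambda\in\mathbb R$. The notation $c_0(d)$, $C_2(d)$, $C_1(\psi,d)$ means positive constants depending only on the listed quantities.
   Formalization: The constants c_0, C_1, C_2 may also depend on the constant K in the sub-Gaussian bound (fixed in advance): with K free the claim fails (errors ±m, d=1, n=2 give Z=m, unbounded in m). The sample spaces range over one arbitrary fixed underlying type. *)

theory Defs
  imports "HOL-Probability.Probability"
begin

text \<open>
  A centered random variable is sub-Gaussian with parameter \<open>\<tau>\<close> iff \<open>sub_gaussian M K \<tau> X\<close> holds
  for some \<open>K > 0\<close>. The witness \<open>K\<close> is kept as an argument because \<open>\<tau>\<close> alone does not control the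
  scale of \<open>X\<close>: a variable uniform on \<open>{-m, m}\<close> satisfies the bound for \<open>\<tau> = 1\<close> and
  \<open>K = exp (m\<^sup>2 / 2)\<close>, for every \<open>m\<close>.
\<close>
definition sub_gaussian :: "'a measure \<Rightarrow> real \<Rightarrow> real \<Rightarrow> ('a \<Rightarrow> real) \<Rightarrow> bool" where
  "sub_gaussian M K \<tau> X \<longleftrightarrow>
     integrable M X \<and> (\<integral>\<omega>. X \<omega> \<partial>M) = 0 \<and>
     (\<forall>l::real. integrable M (\<lambda>\<omega>. exp (l * X \<omega>)) \<and>
        (\<integral>\<omega>. exp (l * X \<omega>) \<partial>M) \<le> K * exp (l\<^sup>2 * \<tau>\<^sup>2 / 2))"

definition iid_vars :: "'a measure \<Rightarrow> ('i \<Rightarrow> 'a \<Rightarrow> real) \<Rightarrow> 'i set \<Rightarrow> bool" where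
  "iid_vars M X I \<longleftrightarrow>
     prob_space.indep_vars M (\<lambda>_. borel) X I \<and>
     (\<forall>i\<in>I. \<forall>j\<in>I. distr M borel (X i) = distr M borel (X j))"

definition max_stat :: "nat \<Rightarrow> nat \<Rightarrow> (nat \<Rightarrow> real) \<Rightarrow> real" where
  "max_stat d n x =
     Max {\<bar>\<Sum>i=n1+1..n2. real (i - n1) ^ d * x i\<bar> /
            (real (n2 - n1) ^ d * sqrt (real (min n2 (n - n1)))) | n1 n2.
          1 \<le> n1 \<and> n1 < n2 \<and> n2 \<le> n}"

text \<open>
  Only the values of \<open>\<psi>\<close> on \<open>[0, \<infinity>)\<close> matter. The inclusion \<open>[1, \<infinity>) \<subseteq> \<psi> [0, \<infinity>)\<close> says that the
  inverse is defined throughout the range of the integral in \<open>inverse_tail_finite\<close>; it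
  holds in particular if \<open>\<psi>\<close> is a bijection of \<open>[0, \<infinity>)\<close>.
\<close>
definition growth_function :: "(real \<Rightarrow> real) \<Rightarrow> bool" where
  "growth_function \<psi> \<longleftrightarrow>
     \<psi> ` {0..} \<subseteq> {0..} \<and> strict_mono_on {0..} \<psi> \<and> continuous_on {0..} \<psi> \<and>
     {1..} \<subseteq> \<psi> ` {0..}"

definition inverse_tail_finite :: "real \<Rightarrow> (real \<Rightarrow> real) \<Rightarrow> bool" where
  "inverse_tail_finite c \<psi> \<longleftrightarrow>
     (\<integral>\<^sup>+ t\<in>{1..}. ennreal (exp (- c * (the_inv_into {0..} \<psi> t)\<^sup>2)) \<partial>lborel) < \<infinity>"

end

theory Submission
  imports Defs
begin

text \<open>
  The weights \<open>((i - n\<^sub>1) / (n\<^sub>2 - n\<^sub>1)) ^ d\<close> increase from \<open>0\<close> to \<open>1\<close>, so by Abel summation the weighted sum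
  is at most the largest unweighted sum over an interval \<open>{j..n\<^sub>2}\<close> with \<open>j > n\<^sub>1\<close>. Such a sum is a difference
  of two sums over initial segments of length at most \<open>n\<^sub>2\<close>, and also of two sums over final segments of
  length at most \<open>n - n\<^sub>1\<close>. Hence \<open>Z\<close> is at most twice the maximum of \<open>\<bar>S\<^sub>k\<bar> / sqrt k\<close> over \<open>k \<le> n\<close>, taken over
  the sequence and its reversal. A maximal inequality on each of the \<open>O (log n)\<close> dyadic blocks of indices gives
  \<open>P (Z \<ge> y) \<le> 8 log (16 n) exp (- c y\<^sup>2)\<close>. For \<open>y\<^sup>2 \<ge> (2 / c) log log (16 n)\<close> half of the exponent absorbs the
  logarithmic factor, and integrating the tail of \<open>\<psi> (Z)\<close> finishes the proof.
\<close>

section \<open>Two elementary inequalities\<close>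

text \<open>Taylor's formula with Lagrange remainder. The linear term is kept exactly, so that it
  integrates to zero for a centered variable.\<close>

lemma exp_le_one_plus_sq:
  fixes y :: real shows "exp y \<le> 1 + y + y\<^sup>2 / 2 * exp \<bar>y\<bar>"
proof -
  obtain t where t: "\<bar>t\<bar> \<le> \<bar>y\<bar>" and e: "exp y = (\<Sum>m<2. y ^ m / fact m) + exp t / fact 2 * y ^ 2"
    using Maclaurin_exp_le[of y 2] by blast
  have "exp t / fact 2 * y ^ 2 \<le> y\<^sup>2 / 2 * exp \<bar>y\<bar>"
    using t mult_right_mono[of "exp t" "exp \<bar>y\<bar>" "y\<^sup>2 / 2"] by (simp add: algebra_simps)
  then show ?thesis using e by (simp add: eval_nat_numeral)
qed

text \<open>Abel summation as a downward induction on \<open>a\<close>: taking the constant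
  \<open>w a\<close> off all weights costs \<open>w a * c\<close>, and the remaining weights on
  \<open>{Suc a..b}\<close> are again nonnegative and increasing, with last value
  \<open>w b - w a\<close>.\<close>

lemma weighted_sum_abs_le:
  fixes w x :: "nat \<Rightarrow> real"
  assumes "a \<le> b" "0 \<le> w a" "mono_on {a..b} w"
    and "\<And>j. j \<in> {a..b} \<Longrightarrow> \<bar>\<Sum>i=j..b. x i\<bar> \<le> c"
  shows "\<bar>\<Sum>i=a..b. w i * x i\<bar> \<le> w b * c"
  using assms
proof (induction a arbitrary: w rule: inc_induct)
  case base
  then show ?case by (simp add: abs_mult mult_left_mono)
next
  case (step a)
  let ?v = "\<lambda>i. w i - w a"
  have m: "w i \<le> w j" if "a \<le> i" "i \<le> j" "j \<le> b" for i j
    using monotone_onD[OF step.prems(2)] that by auto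
  have IH: "\<bar>\<Sum>i=Suc a..b. ?v i * x i\<bar> \<le> ?v b * c"
    using step.hyps m
    by (intro step.IH step.prems(3)) (auto simp: monotone_on_def)
  have "w a * \<bar>\<Sum>i=a..b. x i\<bar> \<le> w a * c"
    using step.hyps step.prems by (intro mult_left_mono) auto
  moreover have "(\<Sum>i=a..b. w i * x i) = w a * (\<Sum>i=a..b. x i) + (\<Sum>i=Suc a..b. ?v i * x i)"
    using step.hyps by (simp add: sum.atLeast_Suc_atMost sum_distrib_left algebra_simps sum_subtractf)
  moreover have "\<bar>w a * (\<Sum>i=a..b. x i)\<bar> = w a * \<bar>\<Sum>i=a..b. x i\<bar>"
    using step.prems(1) by (simp add: abs_mult)
  moreover have "w b * c = w a * c + ?v b * c"
    by (simp add: algebra_simps)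
  ultimately show ?case
    using IH by linarith
qed

section \<open>The statistic and its reduction to partial sums\<close>

lemma max_stat_finite:
  "finite {\<bar>\<Sum>i=n1+1..n2. real (i - n1) ^ d * x i\<bar> /
            (real (n2 - n1) ^ d * sqrt (real (min n2 (n - n1)))) | n1 n2.
          1 \<le> n1 \<and> n1 < n2 \<and> n2 \<le> n}"
  by (rule finite_subset[of _ "(\<lambda>(n1, n2). \<bar>\<Sum>i=n1+1..n2. real (i - n1) ^ d * x i\<bar> /
            (real (n2 - n1) ^ d * sqrt (real (min n2 (n - n1))))) ` ({..n} \<times> {..n})"]) auto

lemma max_stat_attained:
  assumes "n \<ge> 2"
  obtains n1 n2 where "1 \<le> n1" "n1 < n2" "n2 \<le> n"
    "max_stat d n x = \<bar>\<Sum>i=n1+1..n2. real (i - n1) ^ d * x i\<bar> /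
            (real (n2 - n1) ^ d * sqrt (real (min n2 (n - n1))))"
proof -
  let ?S = "{\<bar>\<Sum>i=n1+1..n2. real (i - n1) ^ d * x i\<bar> /
            (real (n2 - n1) ^ d * sqrt (real (min n2 (n - n1)))) | n1 n2.
          1 \<le> n1 \<and> n1 < n2 \<and> n2 \<le> n}"
  have "\<exists>n1 n2. 1 \<le> n1 \<and> n1 < n2 \<and> n2 \<le> n"
    using assms by (intro exI[of _ 1] exI[of _ 2]) auto
  then have "?S \<noteq> {}" by blast
  then have "max_stat d n x \<in> ?S"
    unfolding max_stat_def using max_stat_finite by (rule Max_in[rotated])
  then show ?thesis using that by blast
qed

lemma max_stat_nonneg: "n \<ge> 2 \<Longrightarrow> 0 \<le> max_stat d n x"
  by (erule max_stat_attained[of n d x]) simp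

lemma max_stat_measurable:
  fixes \<epsilon> :: "nat \<Rightarrow> 'a \<Rightarrow> real"
  assumes "\<And>i. i \<in> {1..n} \<Longrightarrow> \<epsilon> i \<in> borel_measurable M"
  shows "(\<lambda>\<omega>. max_stat d n (\<lambda>i. \<epsilon> i \<omega>)) \<in> borel_measurable M"
proof -
  let ?P = "{(n1, n2). 1 \<le> n1 \<and> n1 < n2 \<and> n2 \<le> n}"
  have "finite ?P"
    by (rule finite_subset[of _ "{..n} \<times> {..n}"]) auto
  moreover have "max_stat d n x = (MAX p\<in>?P. case p of (n1, n2) \<Rightarrow>
      \<bar>\<Sum>i=n1+1..n2. real (i - n1) ^ d * x i\<bar> /
            (real (n2 - n1) ^ d * sqrt (real (min n2 (n - n1)))))" for x
    unfolding max_stat_def by (rule arg_cong[where f=Max]) auto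
  ultimately show ?thesis
    using assms
    by (auto intro!: borel_measurable_Max borel_measurable_divide borel_measurable_abs borel_measurable_sum
      simp: split_beta)
qed

text \<open>The factor 1/2 is a pigeonhole: an interval sum is a difference of two partial sums, one
  of which carries at least half of it. The smaller of \<open>n2\<close> and \<open>n - n1\<close>
  decides whether the sequence or its reversal supplies partial sums short enough for the
  normalisation.\<close>

lemma max_stat_ge_imp_partial_sum_ge:
  fixes x :: "nat \<Rightarrow> real"
  assumes n: "n \<ge> 2" and y: "0 \<le> y" "y \<le> max_stat d n x"
  shows "\<exists>k\<in>{1..n}. y / 2 * sqrt k \<le> \<bar>\<Sum>i=1..k. x i\<bar> \<or> y / 2 * sqrt k \<le> \<bar>\<Sum>i=1..k. x (n + 1 - i)\<bar>"
proof -
  define S where "S k = (\<Sum>i=1..k. x i)" for k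
  define R where "R k = (\<Sum>i=1..k. x (n + 1 - i))" for k
  obtain n1 n2 where n12: "1 \<le> n1" "n1 < n2" "n2 \<le> n"
    and ms: "max_stat d n x = \<bar>\<Sum>i=n1+1..n2. real (i - n1) ^ d * x i\<bar> /
            (real (n2 - n1) ^ d * sqrt (real (min n2 (n - n1))))"
    by (rule max_stat_attained[OF n])
  define T where "T j = \<bar>\<Sum>i=j..n2. x i\<bar>" for j
  let ?s = "sqrt (real (min n2 (n - n1)))"
  \<comment> \<open>The best starting index is fixed, so that \<open>T j\<close> can serve as the
    uniform bound in \<open>weighted_sum_abs_le\<close>; the last weight there cancels the power in
    the denominator.\<close>
  have "Max (T ` {n1+1..n2}) \<in> T ` {n1+1..n2}" using n12 by (intro Max_in) auto
  then obtain j where j: "n1 + 1 \<le> j" "j \<le> n2" and Tj: "T j = Max (T ` {n1+1..n2})" by auto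
  have "\<bar>\<Sum>i=n1+1..n2. real (i - n1) ^ d * x i\<bar> \<le> real (n2 - n1) ^ d * T j"
  proof (rule weighted_sum_abs_le)
    show "mono_on {n1 + 1..n2} (\<lambda>i. real (i - n1) ^ d)"
      by (auto simp: monotone_on_def intro!: power_mono diff_le_mono)
    show "\<bar>\<Sum>i=k..n2. x i\<bar> \<le> T j" if "k \<in> {n1 + 1..n2}" for k
      using that unfolding Tj by (auto simp: T_def[symmetric])
  qed (use n12 in auto)
  then have "max_stat d n x \<le> T j / ?s"
    unfolding ms using n12 by (simp add: field_simps)
  then have "y \<le> T j / ?s" using y by simp
  then have yT: "y * ?s \<le> T j"
    using n12 by (simp add: pos_le_divide_eq)
  have TS: "T j \<le> \<bar>S n2\<bar> + \<bar>S (j - 1)\<bar>"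
  proof -
    have "{1..n2} = {1..j-1} \<union> {j..n2}" using j n12 by auto
    then have "S n2 = S (j - 1) + (\<Sum>i=j..n2. x i)"
      unfolding S_def by (subst sum.union_disjoint[symmetric]) (use j in auto)
    then show ?thesis unfolding T_def by linarith
  qed
  have R_eq: "R k = (\<Sum>i=n+1-k..n. x i)" if "k \<le> n" for k
    unfolding R_def using that
    by (intro sum.reindex_bij_witness[of _ "\<lambda>i. n + 1 - i" "\<lambda>i. n + 1 - i"]) auto
  \<comment> \<open>Both \<open>n + 1 - j\<close> and \<open>n - n2\<close> are at most
    \<open>n - n1\<close>, because \<open>j\<close> and \<open>n2\<close> exceed
    \<open>n1\<close>.\<close>
  have TR: "T j \<le> \<bar>R (n + 1 - j)\<bar> + \<bar>R (n - n2)\<bar>"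
  proof -
    have "{j..n} = {j..n2} \<union> {n2+1..n}" using j n12 by auto
    then have "(\<Sum>i=j..n. x i) = (\<Sum>i=j..n2. x i) + (\<Sum>i=n2+1..n. x i)"
      by (subst sum.union_disjoint[symmetric]) auto
    moreover have "R (n + 1 - j) = (\<Sum>i=j..n. x i)"
    proof -
      have "n + 1 - j \<le> n" "n + 1 - (n + 1 - j) = j" using j n12 by auto
      then show ?thesis using R_eq[of "n + 1 - j"] by simp
    qed
    moreover have "R (n - n2) = (\<Sum>i=n2+1..n. x i)"
      using R_eq[of "n - n2"] n12 by simp
    ultimately show ?thesis unfolding T_def by linarith
  qed
  \<comment> \<open>If \<open>F k\<close> carries less than half, \<open>F l\<close> carries more
    than half and is nonzero; \<open>F 0 = 0\<close> then excludes \<open>l = 0\<close>, a value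
    that can arise for \<open>l = n - n2\<close>.\<close>
  have split: "\<exists>k\<in>{1..n}. y / 2 * sqrt k \<le> \<bar>F k\<bar>"
    if "y * sqrt (real m) \<le> \<bar>F k\<bar> + \<bar>F l\<bar>" "k \<in> {1..n}" "k \<le> m" "l \<le> m" "l \<le> n" "F 0 = 0" for F :: "nat \<Rightarrow> real" and k l m
  proof -
    have *: "y / 2 * sqrt (real i) \<le> y / 2 * sqrt (real m)" if "i \<le> m" for i
      using that y by (intro mult_left_mono) auto
    show ?thesis
    proof (cases "y / 2 * sqrt m \<le> \<bar>F k\<bar>")
      case True
      then show ?thesis using *[OF that(3)] that(2) by (intro bexI[of _ k]) linarith+
    next
      case False
      then have l: "y / 2 * sqrt m < \<bar>F l\<bar>" using that by simp
      moreover have "0 \<le> y / 2 * sqrt m" using y by simp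
      ultimately have "l \<noteq> 0" using that(6) by (cases "l = 0") auto
      then show ?thesis using l *[OF that(4)] that(5) by (intro bexI[of _ l]) auto
    qed
  qed
  show ?thesis
  proof (cases "n2 \<le> n - n1")
    case True
    then have "y * sqrt (real n2) \<le> \<bar>S n2\<bar> + \<bar>S (j - 1)\<bar>"
      using yT TS by (simp add: min_def)
    then have "\<exists>k\<in>{1..n}. y / 2 * sqrt k \<le> \<bar>S k\<bar>"
      by (rule split) (use j n12 in \<open>auto simp: S_def\<close>)
    then show ?thesis unfolding S_def by blast
  next
    case False
    then have "y * sqrt (real (n - n1)) \<le> \<bar>R (n + 1 - j)\<bar> + \<bar>R (n - n2)\<bar>"
      using yT TR by (simp add: min_def)
    then have "\<exists>k\<in>{1..n}. y / 2 * sqrt k \<le> \<bar>R k\<bar>"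
      by (rule split) (use j n12 in \<open>auto simp: R_def\<close>)
    then show ?thesis unfolding R_def by blast
  qed
qed

section \<open>Maximal inequalities for independent sums\<close>

lemma (in prob_space) indep_var_nn_integral_mult:
  fixes f g :: "'a \<Rightarrow> ennreal"
  assumes "indep_var borel f borel g"
  shows "(\<integral>\<^sup>+\<omega>. f \<omega> * g \<omega> \<partial>M) = (\<integral>\<^sup>+\<omega>. f \<omega> \<partial>M) * (\<integral>\<^sup>+\<omega>. g \<omega> \<partial>M)"
proof -
  have "case_bool borel borel = (\<lambda>_. borel :: ennreal measure)"
    by (simp add: fun_eq_iff split: bool.split)
  then have "indep_vars (\<lambda>_. borel) (case_bool f g) UNIV"
    using assms by (simp add: indep_var_def)
  from indep_vars_nn_integral[OF _ this] show ?thesis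
    by (simp add: UNIV_bool mult.commute)
qed

text \<open>Doob's argument for the exponential supermartingale
  \<open>exp (l * S k - b * l\<^sup>2 * k)\<close>, carried out as an induction on time without
  filtrations. The injection \<open>s\<close> allows the variables to be read in any order, in
  particular reversed.\<close>

lemma (in prob_space) maximal_inequality_exp:
  fixes X :: "'i \<Rightarrow> 'a \<Rightarrow> real" and N :: nat
  assumes ind: "indep_vars (\<lambda>_. borel) X I"
    and s: "inj_on s {1..N}" "s ` {1..N} \<subseteq> I"
    and mgf: "\<And>i. i \<in> I \<Longrightarrow> (\<integral>\<^sup>+\<omega>. exp (l * X i \<omega>) \<partial>M) \<le> exp (b * l\<^sup>2)"
    and l: "0 \<le> l" and b: "0 \<le> b"
  shows "emeasure M {\<omega>\<in>space M. \<exists>k\<in>{1..N}. x \<le> (\<Sum>i=1..k. X (s i) \<omega>)} \<le> exp (b * l\<^sup>2 * N - l * x)"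
proof -
  note One_nat_def [simp del]
  \<comment> \<open>\<open>S\<close>, \<open>C\<close> and \<open>G\<close> are functions of the
    values \<open>v\<close>, so that adaptedness becomes dependence on the first \<open>k\<close>
    coordinates, the form to which independence applies.\<close>
  define S where "S k v = (\<Sum>i=1..k. v (s i))" for k and v :: "'i \<Rightarrow> real"
  define C where "C k v \<longleftrightarrow> (\<exists>j\<in>{1..k::nat}. x \<le> S j v)" for k v
  \<comment> \<open>\<open>G\<close> is the supermartingale on paths that have not yet reached
    \<open>x\<close>. The factor \<open>exp (b * l\<^sup>2 * (N - k))\<close> is at least 1 for
    \<open>k \<le> N\<close>, so the process is at least 1 when it crosses, and freezing it at 1 can
    only lower it.\<close>
  define G where "G k v = (if C k v then 0 else exp (l * (S k v - x) + b * l\<^sup>2 * (real N - real k)))" for k v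
  define V where "V \<omega> = (\<lambda>i. X i \<omega>)" for \<omega>
  have rv: "X (s i) \<in> borel_measurable M" if "i \<in> {1..N}" for i
    using ind s(2) that unfolding indep_vars_def2 by blast
  have S_meas: "S k \<in> borel_measurable (PiM (s ` {1..m}) (\<lambda>_. borel))" if "k \<le> m" for k m
    unfolding S_def using that by (intro borel_measurable_sum measurable_component_singleton) auto
  have C_meas: "Measurable.pred (PiM (s ` {1..m}) (\<lambda>_. borel)) (C k)" if "k \<le> m" for k m
    unfolding C_def not_less[symmetric] using that
    by (intro pred_intros_finite pred_intros_logic borel_measurable_pred_less S_meas borel_measurable_const) auto
  have G_meas: "G k \<in> borel_measurable (PiM (s ` {1..m}) (\<lambda>_. borel))" if "k \<le> m" for k m
    unfolding G_def using S_meas[OF that] C_meas[OF that] by measurable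
  have V_meas: "(\<lambda>\<omega>. restrict (V \<omega>) (s ` {1..m})) \<in> measurable M (PiM (s ` {1..m}) (\<lambda>_. borel))" if "m \<le> N" for m
    unfolding V_def using that by (intro measurable_restrict) (auto intro: rv)
  have S_restrict: "S k (restrict v (s ` {1..m})) = S k v" if "k \<le> m" for k m v
    unfolding S_def using that by (intro sum.cong) auto
  have C_restrict: "C k (restrict v (s ` {1..m})) = C k v" if "k \<le> m" for k m v
    unfolding C_def using that by (intro bex_cong) (auto simp: S_restrict)
  have G_restrict: "G k (restrict v (s ` {1..m})) = G k v" if "k \<le> m" for k m v
    unfolding G_def using that by (simp add: S_restrict C_restrict)
  have CV: "Measurable.pred M (\<lambda>\<omega>. C k (V \<omega>))" if "k \<le> N" for k
    using measurable_compose[OF V_meas[OF that] C_meas[OF order_refl]] by (simp add: C_restrict)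
  have GV: "(\<lambda>\<omega>. G k (V \<omega>)) \<in> borel_measurable M" if "k \<le> N" for k
    using measurable_compose[OF V_meas[OF that] G_meas[OF order_refl]] by (simp add: G_restrict)
  txt \<open>\<open>Q k\<close> is the mean of a supermartingale that is frozen at \<open>1\<close> once some partial sum reaches \<open>x\<close>.\<close>
  define Q where "Q k = (\<integral>\<^sup>+\<omega>. of_bool (C k (V \<omega>)) + ennreal (G k (V \<omega>)) \<partial>M)" for k
  have Q_le: "Q k \<le> exp (b * l\<^sup>2 * N - l * x)" if "k \<le> N" for k
    using that
  proof (induction k)
    case 0
    \<comment> \<open>\<open>{1..0}\<close> is empty, so nothing has crossed at time 0, and the
      initial value is the claimed bound.\<close>
    have "Q 0 = (\<integral>\<^sup>+\<omega>. ennreal (exp (b * l\<^sup>2 * N - l * x)) \<partial>M)"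
      unfolding Q_def by (simp add: C_def G_def S_def algebra_simps)
    then show ?case by (simp add: emeasure_space_1)
  next
    case (Suc k)
    let ?Y = "\<lambda>\<omega>. exp (l * X (s (Suc k)) \<omega>)"
    have kN: "k \<le> N" and sk: "s (Suc k) \<in> I" using Suc.prems s(2) by auto
    note [measurable] = CV[OF kN] GV[OF kN]
    have [measurable]: "X (s (Suc k)) \<in> borel_measurable M" using rv[of "Suc k"] Suc.prems by simp
    \<comment> \<open>Injectivity of \<open>s\<close> keeps the next variable outside the first
      \<open>k\<close>, hence independent of \<open>G k\<close>.\<close>
    have disj: "s ` {1..k} \<inter> {s (Suc k)} = {}"
      using inj_on_image_mem_iff[OF s(1), of "Suc k" "{1..k}"] Suc.prems by simp
    have "indep_var (PiM (s ` {1..k}) (\<lambda>_. borel)) (\<lambda>\<omega>. restrict (V \<omega>) (s ` {1..k}))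
       (PiM {s (Suc k)} (\<lambda>_. borel)) (\<lambda>\<omega>. restrict (V \<omega>) {s (Suc k)})"
      unfolding V_def using s(2) kN sk by (intro indep_var_restrict[OF ind disj]) auto
    then have "indep_var borel ((\<lambda>v. ennreal (G k v)) \<circ> (\<lambda>\<omega>. restrict (V \<omega>) (s ` {1..k})))
       borel ((\<lambda>v. ennreal (exp (l * v (s (Suc k))))) \<circ> (\<lambda>\<omega>. restrict (V \<omega>) {s (Suc k)}))"
    proof (rule indep_var_compose)
      show "(\<lambda>v. ennreal (G k v)) \<in> borel_measurable (PiM (s ` {1..k}) (\<lambda>_. borel))"
        using G_meas[of k k] by simp
    qed measurable
    then have "indep_var borel (\<lambda>\<omega>. ennreal (G k (V \<omega>))) borel (\<lambda>\<omega>. ennreal (?Y \<omega>))"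
      by (simp add: comp_def G_restrict) (simp add: V_def)
    from indep_var_nn_integral_mult[OF this]
    have prod: "(\<integral>\<^sup>+\<omega>. ennreal (G k (V \<omega>)) * ennreal (?Y \<omega>) \<partial>M) \<le> (\<integral>\<^sup>+\<omega>. G k (V \<omega>) \<partial>M) * exp (b * l\<^sup>2)"
      using mgf[OF sk] by (simp add: mult_left_mono)
    \<comment> \<open>On paths that have not crossed before, the right side equals
      \<open>?e\<close>. The left side is \<open>?e\<close> again or, when the crossing happens now,
      1, which is at most \<open>?e\<close>.\<close>
    have step: "of_bool (C (Suc k) v) + ennreal (G (Suc k) v)
      \<le> of_bool (C k v) + exp (- b * l\<^sup>2) * (ennreal (G k v) * ennreal (exp (l * v (s (Suc k)))))" for v
    proof (cases "C k v")
      case True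
      then have "C (Suc k) v" unfolding C_def by force
      then show ?thesis using True by (simp add: G_def)
    next
      case False
      let ?e = "exp (l * (S (Suc k) v - x) + b * l\<^sup>2 * (real N - real (Suc k)))"
      have rhs: "exp (- b * l\<^sup>2) * (ennreal (G k v) * ennreal (exp (l * v (s (Suc k))))) = ennreal ?e"
        using False by (simp add: G_def S_def ennreal_mult'[symmetric] exp_add[symmetric] algebra_simps)
      have "1 \<le> ?e" if "C (Suc k) v"
      proof -
        have "x \<le> S (Suc k) v" using that False by (auto simp: C_def le_Suc_eq)
        then show ?thesis using l b Suc.prems by simp
      qed
      then have "of_bool (C (Suc k) v) + ennreal (G (Suc k) v) \<le> ennreal ?e"
        by (auto simp: G_def ennreal_leI)
      then show ?thesis using False unfolding rhs by simp
    qed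
    have "Q (Suc k) \<le> (\<integral>\<^sup>+\<omega>. of_bool (C k (V \<omega>)) + exp (- b * l\<^sup>2) * (ennreal (G k (V \<omega>)) * ennreal (?Y \<omega>)) \<partial>M)"
      unfolding Q_def using step[of "V _"] by (intro nn_integral_mono) (simp only: V_def)
    also have "\<dots> = (\<integral>\<^sup>+\<omega>. of_bool (C k (V \<omega>)) \<partial>M)
      + exp (- b * l\<^sup>2) * (\<integral>\<^sup>+\<omega>. ennreal (G k (V \<omega>)) * ennreal (?Y \<omega>) \<partial>M)"
      by (subst nn_integral_add) (simp_all add: nn_integral_cmult)
    also have "\<dots> \<le> (\<integral>\<^sup>+\<omega>. of_bool (C k (V \<omega>)) \<partial>M)
      + exp (- b * l\<^sup>2) * ((\<integral>\<^sup>+\<omega>. G k (V \<omega>) \<partial>M) * exp (b * l\<^sup>2))"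
      by (intro add_left_mono mult_left_mono prod) simp
    also have "exp (- b * l\<^sup>2) * ((\<integral>\<^sup>+\<omega>. G k (V \<omega>) \<partial>M) * exp (b * l\<^sup>2)) = (\<integral>\<^sup>+\<omega>. G k (V \<omega>) \<partial>M)"
    proof -
      have "ennreal (exp (- b * l\<^sup>2)) * ennreal (exp (b * l\<^sup>2)) = 1"
        by (simp add: ennreal_mult'[symmetric] exp_add[symmetric])
      then show ?thesis by (metis mult.assoc mult.commute mult.right_neutral)
    qed
    also have "(\<integral>\<^sup>+\<omega>. of_bool (C k (V \<omega>)) \<partial>M) + (\<integral>\<^sup>+\<omega>. G k (V \<omega>) \<partial>M) = Q k"
      unfolding Q_def by (subst nn_integral_add) simp_all
    finally show ?case using Suc.IH[OF kN] by (rule order_trans)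
  qed
  note [measurable] = CV[OF order_refl]
  have "emeasure M {\<omega>\<in>space M. C N (V \<omega>)} = (\<integral>\<^sup>+\<omega>. indicator {\<omega>\<in>space M. C N (V \<omega>)} \<omega> \<partial>M)"
    by simp
  also have "\<dots> \<le> Q N"
    unfolding Q_def by (intro nn_integral_mono) (auto simp: indicator_def)
  also note Q_le[OF order_refl]
  finally show ?thesis by (simp add: C_def S_def V_def)
qed

text \<open>The moment bound is even in \<open>l\<close>, so the one-sided inequality applies to
  \<open>X\<close> and to its negative alike; the factor 2 comes from the union of the two
  events.\<close>

lemma (in prob_space) maximal_inequality_abs:
  fixes X :: "'i \<Rightarrow> 'a \<Rightarrow> real" and N :: nat
  assumes ind: "indep_vars (\<lambda>_. borel) X I"
    and s: "inj_on s {1..N}" "s ` {1..N} \<subseteq> I"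
    and mgf: "\<And>i l. i \<in> I \<Longrightarrow> (\<integral>\<^sup>+\<omega>. exp (l * X i \<omega>) \<partial>M) \<le> exp (b * l\<^sup>2)"
    and b: "0 < b" and x: "0 \<le> x" and N: "N \<ge> 1"
  shows "prob {\<omega>\<in>space M. \<exists>k\<in>{1..N}. x \<le> \<bar>\<Sum>i=1..k. X (s i) \<omega>\<bar>} \<le> 2 * exp (- x\<^sup>2 / (4 * b * N))"
proof -
  have rv [measurable]: "X (s i) \<in> borel_measurable M" if "i \<in> {1..N}" for i
    using ind s(2) that unfolding indep_vars_def2 by blast
  define E where "E c = {\<omega>\<in>space M. \<exists>k\<in>{1..N}. x \<le> (\<Sum>i=1..k. c * X (s i) \<omega>)}" for c :: real
  have E_sets: "E c \<in> sets M" for c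
    unfolding E_def by measurable
  \<comment> \<open>This \<open>l\<close> minimises the exponent
    \<open>b * l\<^sup>2 * N - l * x\<close>.\<close>
  define l where "l = x / (2 * b * N)"
  have e: "b * l\<^sup>2 * N - l * x = - x\<^sup>2 / (4 * b * N)"
    using b N by (simp add: l_def field_simps power2_eq_square)
  have E_le: "prob (E c) \<le> exp (- x\<^sup>2 / (4 * b * N))" if "c\<^sup>2 = 1" for c
  proof -
    have "emeasure M (E c) \<le> exp (b * l\<^sup>2 * N - l * x)"
      unfolding E_def
    proof (rule maximal_inequality_exp[where X = "\<lambda>i \<omega>. c * X i \<omega>" and I = I])
      show "indep_vars (\<lambda>_. borel) (\<lambda>i \<omega>. c * X i \<omega>) I"
        by (rule indep_vars_compose2[OF ind]) simp
      show "(\<integral>\<^sup>+\<omega>. exp (l * (c * X i \<omega>)) \<partial>M) \<le> exp (b * l\<^sup>2)" if "i \<in> I" for i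
        using mgf[OF that, of "l * c"] \<open>c\<^sup>2 = 1\<close> by (simp add: mult.assoc power_mult_distrib)
    qed (use s b x in \<open>auto simp: l_def\<close>)
    then show ?thesis unfolding e by (simp add: emeasure_eq_measure)
  qed
  have "{\<omega>\<in>space M. \<exists>k\<in>{1..N}. x \<le> \<bar>\<Sum>i=1..k. X (s i) \<omega>\<bar>} \<subseteq> E 1 \<union> E (-1)"
  proof safe
    fix \<omega> k assume \<omega>: "\<omega> \<in> space M" "k \<in> {1..N}" "x \<le> \<bar>\<Sum>i=1..k. X (s i) \<omega>\<bar>" "\<omega> \<notin> E (-1)"
    then have "\<not> x \<le> - (\<Sum>i=1..k. X (s i) \<omega>)" by (auto simp: E_def sum_negf)
    then have "x \<le> (\<Sum>i=1..k. X (s i) \<omega>)" using \<omega>(3) by linarith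
    then show "\<omega> \<in> E 1" using \<omega>(1,2) by (auto simp: E_def)
  qed
  then have "prob {\<omega>\<in>space M. \<exists>k\<in>{1..N}. x \<le> \<bar>\<Sum>i=1..k. X (s i) \<omega>\<bar>} \<le> prob (E 1 \<union> E (-1))"
    using E_sets by (intro finite_measure_mono) auto
  also have "\<dots> \<le> prob (E 1) + prob (E (-1))"
    using E_sets by (intro measure_Un_le) auto
  also have "\<dots> \<le> 2 * exp (- x\<^sup>2 / (4 * b * N))"
    using E_le[of 1] E_le[of "-1"] by simp
  finally show ?thesis .
qed

text \<open>Peeling: on a dyadic block of indices the normalisation \<open>sqrt k\<close> is constant up to a factor.\<close>

lemma (in prob_space) normalized_sums_dyadic_tail:
  fixes X :: "'i \<Rightarrow> 'a \<Rightarrow> real" and n :: nat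
  assumes ind: "indep_vars (\<lambda>_. borel) X I"
    and s: "inj_on s {1..n}" "s ` {1..n} \<subseteq> I"
    and mgf: "\<And>i l. i \<in> I \<Longrightarrow> (\<integral>\<^sup>+\<omega>. exp (l * X i \<omega>) \<partial>M) \<le> exp (b * l\<^sup>2)"
    and b: "0 < b" and y: "0 \<le> y" and n: "n \<ge> 1"
  shows "prob {\<omega>\<in>space M. \<exists>k\<in>{1..n}. k < 2 ^ L \<and> y * sqrt k \<le> \<bar>\<Sum>i=1..k. X (s i) \<omega>\<bar>}
    \<le> 2 * real L * exp (- y\<^sup>2 / (8 * b))"
proof -
  have rv [measurable]: "X (s i) \<in> borel_measurable M" if "i \<in> {1..n}" for i
    using ind s(2) that unfolding indep_vars_def2 by blast
  define S where "S k \<omega> = (\<Sum>i=1..k. X (s i) \<omega>)" for k \<omega>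
  have S_meas [measurable]: "S k \<in> borel_measurable M" if "k \<in> {1..n}" for k
    unfolding S_def using that by (intro borel_measurable_sum rv) auto
  have "prob {\<omega>\<in>space M. \<exists>k\<in>{1..n}. k < 2 ^ L \<and> y * sqrt k \<le> \<bar>S k \<omega>\<bar>}
    \<le> 2 * real L * exp (- y\<^sup>2 / (8 * b))"
  proof (induction L)
    case 0
    have "{\<omega>\<in>space M. \<exists>k\<in>{1..n}. k < 2 ^ 0 \<and> y * sqrt k \<le> \<bar>S k \<omega>\<bar>} = {}" by auto
    then show ?case by simp
  next
    case (Suc L)
    \<comment> \<open>The right end of the block is cut off at \<open>n\<close>, since
      \<open>s\<close> is controlled on \<open>{1..n}\<close> only.\<close>
    define N where "N = min n (2 ^ Suc L)"
    have N: "N \<ge> 1" "N \<le> n" "real N \<le> 2 ^ Suc L"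
    proof -
      show "N \<ge> 1" "N \<le> n" using n by (auto simp: N_def)
      have "real N \<le> real (2 ^ Suc L)" unfolding N_def by (intro of_nat_mono) simp
      then show "real N \<le> 2 ^ Suc L" by simp
    qed
    let ?A = "{\<omega>\<in>space M. \<exists>k\<in>{1..n}. k < 2 ^ L \<and> y * sqrt k \<le> \<bar>S k \<omega>\<bar>}"
    let ?B = "{\<omega>\<in>space M. \<exists>k\<in>{1..N}. y * sqrt (2 ^ L) \<le> \<bar>S k \<omega>\<bar>}"
    have A_sets: "?A \<in> sets M" by measurable
    have SN: "S k \<in> borel_measurable M" if "k \<in> {1..N}" for k
      using that N by (intro S_meas) auto
    note [measurable] = SN
    have B_sets: "?B \<in> sets M" by measurable
    have "prob ?B \<le> 2 * exp (- (y * sqrt (2 ^ L))\<^sup>2 / (4 * b * N))"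
      unfolding S_def
    proof (rule maximal_inequality_abs[OF ind _ _ mgf b])
      show "inj_on s {1..N}" "s ` {1..N} \<subseteq> I"
        using s N by (auto intro: inj_on_subset)
    qed (use y N in auto)
    also have "\<dots> \<le> 2 * exp (- y\<^sup>2 / (8 * b))"
    proof -
      \<comment> \<open>The maximal inequality runs up to \<open>N \<le> 2 * 2 ^ L\<close>, while
        the threshold uses the left end \<open>2 ^ L\<close>: the exponent loses a factor 2, hence 8
        in place of 4.\<close>
      have "y\<^sup>2 / (8 * b) = y\<^sup>2 * 2 ^ L / (4 * b * 2 ^ Suc L)"
        using b by (simp add: field_simps)
      also have "\<dots> \<le> y\<^sup>2 * 2 ^ L / (4 * b * N)"
        using b N by (intro divide_left_mono mult_left_mono) auto
      finally show ?thesis by (simp add: power_mult_distrib)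
    qed
    finally have B_le: "prob ?B \<le> 2 * exp (- y\<^sup>2 / (8 * b))" .
    have "{\<omega>\<in>space M. \<exists>k\<in>{1..n}. k < 2 ^ Suc L \<and> y * sqrt k \<le> \<bar>S k \<omega>\<bar>} \<subseteq> ?A \<union> ?B"
    proof safe
      fix \<omega> k assume \<omega>: "\<omega> \<in> space M" "k \<in> {1..n}" "k < 2 ^ Suc L" "y * sqrt k \<le> \<bar>S k \<omega>\<bar>"
        and notB: "\<not> (\<exists>k\<in>{1..N}. y * sqrt (2 ^ L) \<le> \<bar>S k \<omega>\<bar>)"
      have kN: "k \<in> {1..N}" using \<omega> by (simp add: N_def)
      have "k < 2 ^ L"
      proof (rule ccontr)
        assume "\<not> k < 2 ^ L"
        then have "real (2 ^ L) \<le> real k" by (intro of_nat_mono) simp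
        then have "y * sqrt (2 ^ L) \<le> y * sqrt k"
          using y by (intro mult_left_mono) auto
        then show False using notB kN \<omega>(4) by force
      qed
      then show "\<exists>k\<in>{1..n}. k < 2 ^ L \<and> y * sqrt k \<le> \<bar>S k \<omega>\<bar>" using \<omega> by blast
    qed
    then have "prob {\<omega>\<in>space M. \<exists>k\<in>{1..n}. k < 2 ^ Suc L \<and> y * sqrt k \<le> \<bar>S k \<omega>\<bar>} \<le> prob (?A \<union> ?B)"
      using A_sets B_sets by (intro finite_measure_mono) auto
    also have "\<dots> \<le> prob ?A + prob ?B"
      using A_sets B_sets by (rule measure_Un_le)
    finally show ?case using Suc.IH B_le by (simp add: algebra_simps)
  qed
  then show ?thesis unfolding S_def .
qed

section \<open>From sub-Gaussian moments to the tail of the statistic\<close>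

text \<open>Trades the prefactor \<open>K\<close> for a larger constant in the exponent, so that
  sums of many variables do not accumulate powers of \<open>K\<close>. For small \<open>l\<close>
  the zero mean removes the linear term and leaves 1 plus a multiple of \<open>l\<^sup>2\<close>;
  for \<open>\<bar>l\<bar> > 1\<close> the prefactor is at most
  \<open>exp (K * l\<^sup>2)\<close>.\<close>

lemma (in prob_space) sub_gaussian_mgf_le:
  assumes sg: "sub_gaussian M K 1 X" and K: "0 < K"
  shows "(\<integral>\<^sup>+\<omega>. exp (l * X \<omega>) \<partial>M) \<le> exp (2 * K * exp 2 * l\<^sup>2)"
proof -
  have int: "integrable M X" and mean: "expectation X = 0"
    and exp_int: "integrable M (\<lambda>\<omega>. exp (l * X \<omega>))"
    and mgf: "expectation (\<lambda>\<omega>. exp (l * X \<omega>)) \<le> K * exp (l\<^sup>2 / 2)" for l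
    using sg unfolding sub_gaussian_def by auto
  have "expectation (\<lambda>\<omega>. exp (l * X \<omega>)) \<le> exp (2 * K * exp 2 * l\<^sup>2)"
  proof (cases "\<bar>l\<bar> \<le> 1")
    case True
    \<comment> \<open>In the Taylor remainder \<open>z\<^sup>2 / 2\<close> and
      \<open>exp \<bar>l * z\<bar>\<close> are each at most \<open>exp \<bar>z\<bar>\<close>. What
      remains involves the moment bound at 2 and -2 only, where its value \<open>K * exp 2\<close>
      yields the constant.\<close>
    have pointwise: "exp (l * z) \<le> 1 + l * z + l\<^sup>2 * (exp (2 * z) + exp (- 2 * z))" for z
    proof -
      have "\<bar>l * z\<bar> \<le> \<bar>z\<bar>" using True by (simp add: abs_mult mult_left_le_one_le)
      then have "exp \<bar>l * z\<bar> \<le> exp \<bar>z\<bar>" by simp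
      moreover have "z\<^sup>2 / 2 \<le> exp \<bar>z\<bar>"
        using exp_lower_Taylor_quadratic[of "\<bar>z\<bar>"] by simp
      ultimately have "z\<^sup>2 / 2 * exp \<bar>l * z\<bar> \<le> exp \<bar>z\<bar> * exp \<bar>z\<bar>"
        by (intro mult_mono) auto
      also have "\<dots> \<le> exp (2 * z) + exp (- 2 * z)"
        by (cases "z \<ge> 0") (auto simp: exp_add[symmetric])
      finally have "l\<^sup>2 * (z\<^sup>2 / 2 * exp \<bar>l * z\<bar>) \<le> l\<^sup>2 * (exp (2 * z) + exp (- 2 * z))"
        by (intro mult_left_mono) auto
      moreover have "(l * z)\<^sup>2 / 2 * exp \<bar>l * z\<bar> = l\<^sup>2 * (z\<^sup>2 / 2 * exp \<bar>l * z\<bar>)"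
        by (simp add: power_mult_distrib)
      ultimately show ?thesis using exp_le_one_plus_sq[of "l * z"] by linarith
    qed
    have "expectation (\<lambda>\<omega>. exp (l * X \<omega>))
      \<le> expectation (\<lambda>\<omega>. 1 + l * X \<omega> + l\<^sup>2 * (exp (2 * X \<omega>) + exp (- 2 * X \<omega>)))"
      by (intro integral_mono exp_int Bochner_Integration.integrable_add integrable_mult_right
         integrable_const int pointwise)
    also have "\<dots> = 1 + l\<^sup>2 * (expectation (\<lambda>\<omega>. exp (2 * X \<omega>)) + expectation (\<lambda>\<omega>. exp (- 2 * X \<omega>)))"
      using exp_int[of 2] exp_int[of "-2"] int mean by (simp add: prob_space)
    also have "\<dots> \<le> 1 + l\<^sup>2 * (K * exp 2 + K * exp 2)"
      using mgf[of 2] mgf[of "-2"] by (intro add_left_mono mult_left_mono add_mono) auto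
    also have "\<dots> \<le> exp (2 * K * exp 2 * l\<^sup>2)"
      using exp_ge_add_one_self[of "2 * K * exp 2 * l\<^sup>2"] by (simp add: algebra_simps)
    finally show ?thesis .
  next
    case False
    \<comment> \<open>At \<open>l = 0\<close> the moment bound reads \<open>1 \<le> K\<close>; this
      absorbs the extra \<open>1 / 2\<close> in the exponent below.\<close>
    have K1: "1 \<le> K" using mgf[of 0] by (simp add: prob_space)
    have l1: "1 \<le> l\<^sup>2" using False one_le_power[of "\<bar>l\<bar>" 2] by simp
    have "K \<le> exp K" using exp_ge_add_one_self[of K] by linarith
    also have "\<dots> \<le> exp (K * l\<^sup>2)" using K l1 by simp
    finally have "K * exp (l\<^sup>2 / 2) \<le> exp (K * l\<^sup>2) * exp (l\<^sup>2 / 2)"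
      by (intro mult_right_mono) auto
    also have "\<dots> = exp ((K + 1 / 2) * l\<^sup>2)" by (simp add: exp_add[symmetric] algebra_simps)
    also have "\<dots> \<le> exp (2 * K * exp 2 * l\<^sup>2)"
    proof -
      have "2 * K * 1 \<le> 2 * K * exp 2" using K by (intro mult_left_mono) auto
      then have "K + 1 / 2 \<le> 2 * K * exp 2" using K1 by linarith
      then show ?thesis by (simp add: mult_right_mono)
    qed
    finally show ?thesis using mgf[of l] by linarith
  qed
  then show ?thesis
    by (subst nn_integral_eq_integral[OF exp_int]) (auto intro: ennreal_leI)
qed

text \<open>The sequence and its reversal contribute \<open>L\<close> dyadic blocks each, every
  block costs a factor 2, and \<open>L\<close> is at most \<open>2 * ln (16 * real n)\<close>:
  together 8. Halving \<open>y\<close> turns the 8 in the exponent of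
  \<open>normalized_sums_dyadic_tail\<close> into 32.\<close>

lemma (in prob_space) max_stat_tail:
  fixes \<epsilon> :: "nat \<Rightarrow> 'a \<Rightarrow> real"
  assumes ind: "indep_vars (\<lambda>_. borel) \<epsilon> {1..n}"
    and mgf: "\<And>i l. i \<in> {1..n} \<Longrightarrow> (\<integral>\<^sup>+\<omega>. exp (l * \<epsilon> i \<omega>) \<partial>M) \<le> exp (b * l\<^sup>2)"
    and b: "0 < b" and y: "0 \<le> y" and n: "n \<ge> 2"
  shows "prob {\<omega>\<in>space M. y \<le> max_stat d n (\<lambda>i. \<epsilon> i \<omega>)} \<le> 8 * ln (16 * real n) * exp (- y\<^sup>2 / (32 * b))"
proof -
  have rv [measurable]: "\<epsilon> i \<in> borel_measurable M" if "i \<in> {1..n}" for i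
    using ind that unfolding indep_vars_def2 by blast
  \<comment> \<open>\<open>L\<close> is the number of binary digits of \<open>n\<close>, so the
    blocks cover all indices up to \<open>n\<close>.\<close>
  define L where "L = nat \<lfloor>log 2 n\<rfloor> + 1"
  have log_nonneg: "0 \<le> log 2 n" using n by simp
  have "log 2 n < L" unfolding L_def using log_nonneg by linarith
  then have "real n < 2 ^ L" using n by (simp add: log_less_iff powr_realpow)
  then have nL: "n < 2 ^ L" by (metis of_nat_less_iff of_nat_numeral of_nat_power)
  \<comment> \<open>\<open>log 2 n\<close> is at most \<open>2 * ln n\<close> because
    \<open>ln 2\<close> exceeds \<open>1 / 2\<close>; the \<open>4 * ln 2\<close> from the factor 16
    pays for the added 1.\<close>
  have L_le: "L \<le> 2 * ln (16 * real n)"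
  proof -
    have "ln n * (1 / 2) \<le> ln n * ln 2"
      using n ln2_ge_two_thirds by (intro mult_left_mono) auto
    then have "log 2 n \<le> 2 * ln n" by (simp add: log_def field_simps)
    moreover have "ln (16 * real n) = 4 * ln 2 + ln n"
    proof -
      have "ln (16 :: real) = 4 * ln 2" using ln_realpow[of 2 4] by simp
      then show ?thesis using n by (simp add: ln_mult)
    qed
    moreover have "L \<le> log 2 n + 1" unfolding L_def using log_nonneg by linarith
    ultimately show ?thesis using ln2_ge_two_thirds by linarith
  qed
  define E where "E s = {\<omega>\<in>space M. \<exists>k\<in>{1..n}. k < 2 ^ L \<and> y / 2 * sqrt k \<le> \<bar>\<Sum>i=1..k. \<epsilon> (s i) \<omega>\<bar>}"
    for s :: "nat \<Rightarrow> nat"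
  have E_sets: "E s \<in> sets M" if "s ` {1..n} \<subseteq> {1..n}" for s
  proof -
    have "\<epsilon> (s i) \<in> borel_measurable M" if "i \<in> {1..n}" for i
      using that \<open>s ` {1..n} \<subseteq> {1..n}\<close> by (intro rv) blast
    note [measurable] = this
    show ?thesis unfolding E_def by measurable
  qed
  have E_le: "prob (E s) \<le> 2 * real L * exp (- (y / 2)\<^sup>2 / (8 * b))" if "inj_on s {1..n}" "s ` {1..n} \<subseteq> {1..n}" for s
    unfolding E_def by (rule normalized_sums_dyadic_tail[OF ind that mgf b]) (use y n in auto)
  let ?r = "\<lambda>i. n + 1 - i"
  have r: "inj_on ?r {1..n}" "?r ` {1..n} \<subseteq> {1..n}" by (auto simp: inj_on_def)
  have "{\<omega>\<in>space M. y \<le> max_stat d n (\<lambda>i. \<epsilon> i \<omega>)} \<subseteq> E (\<lambda>i. i) \<union> E ?r"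
  proof
    fix \<omega> assume \<omega>: "\<omega> \<in> {\<omega>\<in>space M. y \<le> max_stat d n (\<lambda>i. \<epsilon> i \<omega>)}"
    then obtain k where k: "k \<in> {1..n}" "y / 2 * sqrt k \<le> \<bar>\<Sum>i=1..k. \<epsilon> i \<omega>\<bar> \<or> y / 2 * sqrt k \<le> \<bar>\<Sum>i=1..k. \<epsilon> (n + 1 - i) \<omega>\<bar>"
      using max_stat_ge_imp_partial_sum_ge[OF n y, of d "\<lambda>i. \<epsilon> i \<omega>"] by blast
    moreover have "k < 2 ^ L" using k nL by auto
    ultimately show "\<omega> \<in> E (\<lambda>i. i) \<union> E ?r" using \<omega> unfolding E_def by blast
  qed
  then have "prob {\<omega>\<in>space M. y \<le> max_stat d n (\<lambda>i. \<epsilon> i \<omega>)} \<le> prob (E (\<lambda>i. i) \<union> E ?r)"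
    using E_sets[OF r(2)] E_sets[of "\<lambda>i. i"] by (intro finite_measure_mono) auto
  also have "\<dots> \<le> prob (E (\<lambda>i. i)) + prob (E ?r)"
    using E_sets[OF r(2)] E_sets[of "\<lambda>i. i"] by (intro measure_Un_le) auto
  also have "\<dots> \<le> 4 * real L * exp (- (y / 2)\<^sup>2 / (8 * b))"
    using E_le[OF r] E_le[of "\<lambda>i. i"] by simp
  also have "\<dots> \<le> 4 * (2 * ln (16 * real n)) * exp (- (y / 2)\<^sup>2 / (8 * b))"
    using L_le by (intro mult_right_mono mult_left_mono) auto
  also have "- (y / 2)\<^sup>2 / (8 * b) = - y\<^sup>2 / (32 * b)" by (simp add: power_divide)
  finally show ?thesis by simp
qed

section \<open>From the tail to the expectation\<close>

text \<open>Layer-cake integration above \<open>max (\<psi> r) 1\<close>. The exponent is split in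
  half: for arguments beyond \<open>r\<close> one half brings \<open>a\<close> down to
  \<open>B\<close>, and the other is integrable by \<open>inverse_tail_finite\<close>.\<close>

lemma (in prob_space) expectation_growth_function_le:
  assumes gf: "growth_function \<psi>" and fin: "inverse_tail_finite (c / 2) \<psi>"
    and Z [measurable]: "Z \<in> borel_measurable M" and Z0: "\<And>\<omega>. \<omega> \<in> space M \<Longrightarrow> 0 \<le> Z \<omega>"
    and tail: "\<And>y. 0 \<le> y \<Longrightarrow> prob {\<omega>\<in>space M. y \<le> Z \<omega>} \<le> a * exp (- c * y\<^sup>2)"
    and c: "0 < c" and r: "0 \<le> r" and a: "0 \<le> a" and B: "a * exp (- (c / 2) * r\<^sup>2) \<le> B"
  shows "integrable M (\<lambda>\<omega>. \<psi> (Z \<omega>))"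
    and "expectation (\<lambda>\<omega>. \<psi> (Z \<omega>))
      \<le> max (\<psi> r) 1 + B * enn2real (\<integral>\<^sup>+ t\<in>{1..}. exp (- (c / 2) * (the_inv_into {0..} \<psi> t)\<^sup>2) \<partial>lborel)"
proof -
  let ?u = "the_inv_into {0..} \<psi>"
  let ?J = "\<integral>\<^sup>+ t\<in>{1..}. exp (- (c / 2) * (?u t)\<^sup>2) \<partial>lborel"
  define T where "T = max (\<psi> r) 1"
  have B0: "0 \<le> B" using a B by (meson exp_ge_zero mult_nonneg_nonneg order_trans)
  have J: "?J < \<infinity>" using fin unfolding inverse_tail_finite_def .
  have mono: "strict_mono_on {0..} \<psi>" and cont: "continuous_on {0..} \<psi>"
    and nonneg: "\<And>x. 0 \<le> x \<Longrightarrow> 0 \<le> \<psi> x" and surj: "{1..} \<subseteq> \<psi> ` {0..}"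
    using gf unfolding growth_function_def by auto
  have le_iff: "\<psi> x \<le> \<psi> y \<longleftrightarrow> x \<le> y" if "0 \<le> x" "0 \<le> y" for x y
    using strict_mono_on_less_eq[OF mono, of x y] that by simp
  have inj: "inj_on \<psi> {0..}" using mono by (rule strict_mono_on_imp_inj_on)
  have u: "0 \<le> ?u t" "\<psi> (?u t) = t" if "1 \<le> t" for t
    using surj that the_inv_into_into[OF inj, of t "{0..}"] f_the_inv_into_f[OF inj, of t] by auto
  \<comment> \<open>The inverse is known on \<open>[1, \<infinity>)\<close> only; extended to the
    left by its value at 1 it is monotone on the whole line, hence Borel.\<close>
  have "mono (\<lambda>t. ?u (max 1 t))"
    by (rule monoI) (subst le_iff[symmetric], auto simp: u)
  then have u_meas [measurable]: "(\<lambda>t. ?u (max 1 t)) \<in> borel_measurable borel"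
    by (rule borel_measurable_mono)
  \<comment> \<open>Likewise \<open>\<psi>\<close> is known to be continuous on
    \<open>[0, \<infinity>)\<close> only, and composing with \<open>max 0\<close> changes nothing at
    the nonnegative values of \<open>Z\<close>.\<close>
  have "continuous_on UNIV (\<lambda>x. \<psi> (max 0 x))"
    by (rule continuous_on_compose2[OF cont]) (auto intro!: continuous_intros)
  then have "(\<lambda>x. \<psi> (max 0 x)) \<in> borel_measurable borel"
    by (rule borel_measurable_continuous_onI)
  from measurable_compose[OF Z this] have \<psi>Z [measurable]: "(\<lambda>\<omega>. \<psi> (Z \<omega>)) \<in> borel_measurable M"
    by (rule measurable_cong[THEN iffD1, rotated]) (simp add: Z0 max_absorb2)
  have tail_t: "emeasure M {\<omega>\<in>space M. t \<le> \<psi> (Z \<omega>)} \<le> ennreal B * exp (- (c / 2) * (?u t)\<^sup>2)" if t: "T \<le> t" for t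
  proof -
    have t1: "1 \<le> t" and tr: "\<psi> r \<le> t" using t by (auto simp: T_def)
    have "r \<le> ?u t" using tr u[OF t1] le_iff[OF r, of "?u t"] by simp
    then have ru: "r\<^sup>2 \<le> (?u t)\<^sup>2" using r by (intro power_mono)
    have "{\<omega>\<in>space M. t \<le> \<psi> (Z \<omega>)} = {\<omega>\<in>space M. ?u t \<le> Z \<omega>}"
      using u[OF t1] Z0 le_iff[of "?u t"] by auto
    then have "prob {\<omega>\<in>space M. t \<le> \<psi> (Z \<omega>)} \<le> a * exp (- c * (?u t)\<^sup>2)"
      using tail u[OF t1] by simp
    also have "\<dots> = a * exp (- (c / 2) * (?u t)\<^sup>2) * exp (- (c / 2) * (?u t)\<^sup>2)"
      by (simp add: exp_add[symmetric] mult.assoc)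
    also have "\<dots> \<le> a * exp (- (c / 2) * r\<^sup>2) * exp (- (c / 2) * (?u t)\<^sup>2)"
      using a c ru by (intro mult_right_mono mult_left_mono) auto
    also have "\<dots> \<le> B * exp (- (c / 2) * (?u t)\<^sup>2)"
      using B by (intro mult_right_mono) auto
    finally show ?thesis
      using B0 by (simp add: emeasure_eq_measure ennreal_mult'[symmetric] ennreal_leI)
  qed
  \<comment> \<open>The excess of \<open>\<psi> (Z \<omega>)\<close> over \<open>T\<close> is
    written as the length of an interval; Tonelli then replaces the indicator by its
    probability.\<close>
  have "(\<integral>\<^sup>+\<omega>. \<psi> (Z \<omega>) \<partial>M) \<le> (\<integral>\<^sup>+\<omega>. ennreal T + (\<integral>\<^sup>+t. indicator {T..} t * of_bool (t \<le> \<psi> (Z \<omega>)) \<partial>lborel) \<partial>M)"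
  proof (rule nn_integral_mono)
    fix \<omega>
    have "(\<integral>\<^sup>+t. indicator {T..} t * of_bool (t \<le> \<psi> (Z \<omega>)) \<partial>lborel) = (\<integral>\<^sup>+t. indicator {T..\<psi> (Z \<omega>)} t \<partial>lborel)"
      by (intro nn_integral_cong) (auto simp: indicator_def)
    also have "\<dots> = ennreal (\<psi> (Z \<omega>) - T)"
      by (cases "T \<le> \<psi> (Z \<omega>)") (auto simp: ennreal_neg)
    finally have *: "(\<integral>\<^sup>+t. indicator {T..} t * of_bool (t \<le> \<psi> (Z \<omega>)) \<partial>lborel) = ennreal (\<psi> (Z \<omega>) - T)" .
    have "0 \<le> T" by (simp add: T_def)
    then show "ennreal (\<psi> (Z \<omega>)) \<le> ennreal T + (\<integral>\<^sup>+t. indicator {T..} t * of_bool (t \<le> \<psi> (Z \<omega>)) \<partial>lborel)"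
      unfolding * by (cases "T \<le> \<psi> (Z \<omega>)") (auto simp: ennreal_plus[symmetric] ennreal_neg ennreal_leI simp del: ennreal_plus)
  qed
  also have "\<dots> = ennreal T + (\<integral>\<^sup>+\<omega>. (\<integral>\<^sup>+t. indicator {T..} t * of_bool (t \<le> \<psi> (Z \<omega>)) \<partial>lborel) \<partial>M)"
    by (subst nn_integral_add) (auto simp: emeasure_space_1)
  also have "(\<integral>\<^sup>+\<omega>. (\<integral>\<^sup>+t. indicator {T..} t * of_bool (t \<le> \<psi> (Z \<omega>)) \<partial>lborel) \<partial>M)
    = (\<integral>\<^sup>+t. (\<integral>\<^sup>+\<omega>. indicator {T..} t * of_bool (t \<le> \<psi> (Z \<omega>)) \<partial>M) \<partial>lborel)"
  proof -
    interpret P: pair_sigma_finite lborel M ..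
    show ?thesis by (rule P.Fubini') measurable
  qed
  also have "\<dots> = (\<integral>\<^sup>+t. indicator {T..} t * emeasure M {\<omega>\<in>space M. t \<le> \<psi> (Z \<omega>)} \<partial>lborel)"
  proof (rule nn_integral_cong)
    fix t
    have "(\<integral>\<^sup>+\<omega>. of_bool (t \<le> \<psi> (Z \<omega>)) \<partial>M) = (\<integral>\<^sup>+\<omega>. indicator {\<omega>\<in>space M. t \<le> \<psi> (Z \<omega>)} \<omega> \<partial>M)"
      by (intro nn_integral_cong) (auto simp: indicator_def)
    then show "(\<integral>\<^sup>+\<omega>. indicator {T..} t * of_bool (t \<le> \<psi> (Z \<omega>)) \<partial>M) = indicator {T..} t * emeasure M {\<omega>\<in>space M. t \<le> \<psi> (Z \<omega>)}"
      by (simp add: nn_integral_cmult)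
  qed
  \<comment> \<open>Since \<open>T \<ge> 1\<close>, the range can be enlarged to
    \<open>[1, \<infinity>)\<close>, which frees the integral from \<open>r\<close>, and so from
    \<open>n\<close> in the application.\<close>
  also have "\<dots> \<le> (\<integral>\<^sup>+t. ennreal B * (ennreal (exp (- (c / 2) * (?u (max 1 t))\<^sup>2)) * indicator {1..} t) \<partial>lborel)"
  proof (rule nn_integral_mono)
    fix t
    show "indicator {T..} t * emeasure M {\<omega>\<in>space M. t \<le> \<psi> (Z \<omega>)}
      \<le> ennreal B * (ennreal (exp (- (c / 2) * (?u (max 1 t))\<^sup>2)) * indicator {1..} t)"
    proof (cases "T \<le> t")
      case True
      then have "1 \<le> t" by (simp add: T_def)
      then show ?thesis using tail_t[OF True] True by (simp add: max_absorb2)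
    qed simp
  qed
  also have "\<dots> = ennreal B * (\<integral>\<^sup>+t. ennreal (exp (- (c / 2) * (?u (max 1 t))\<^sup>2)) * indicator {1..} t \<partial>lborel)"
    by (rule nn_integral_cmult) measurable
  also have "(\<integral>\<^sup>+t. ennreal (exp (- (c / 2) * (?u (max 1 t))\<^sup>2)) * indicator {1..} t \<partial>lborel) = ?J"
    by (intro nn_integral_cong) (auto simp: indicator_def max_absorb2)
  also have "ennreal T + ennreal B * ?J = ennreal (T + B * enn2real ?J)"
    using J B0 by (simp add: T_def ennreal_plus ennreal_mult' ennreal_enn2real)
  finally have main: "(\<integral>\<^sup>+\<omega>. \<psi> (Z \<omega>) \<partial>M) \<le> ennreal (T + B * enn2real ?J)"
    by (simp add: add_left_mono)
  have \<psi>Z0: "AE \<omega> in M. 0 \<le> \<psi> (Z \<omega>)" using nonneg Z0 by simp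
  show int: "integrable M (\<lambda>\<omega>. \<psi> (Z \<omega>))"
    using main by (intro integrableI_nonneg \<psi>Z \<psi>Z0) (auto intro: le_less_trans)
  from main have "ennreal (expectation (\<lambda>\<omega>. \<psi> (Z \<omega>))) \<le> ennreal (T + B * enn2real ?J)"
    unfolding nn_integral_eq_integral[OF int \<psi>Z0] .
  moreover have "0 \<le> T + B * enn2real ?J" using B0 by (simp add: T_def)
  ultimately show "expectation (\<lambda>\<omega>. \<psi> (Z \<omega>)) \<le> max (\<psi> r) 1 + B * enn2real ?J"
    unfolding T_def by (rule ennreal_le_iff[THEN iffD1, rotated])
qed

section \<open>Choice of the constants\<close>

theorem theorem4p1:
  fixes d :: nat and K :: real
  assumes "d \<ge> 1" and "K > 0"
  shows "\<exists>c0>0. \<exists>C2>0. \<forall>\<psi>. growth_function \<psi> \<and> inverse_tail_finite c0 \<psi> \<longrightarrow>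
    (\<exists>C1>0. \<forall>(n::nat) (M :: 'a measure) (\<epsilon> :: nat \<Rightarrow> 'a \<Rightarrow> real).
       n \<ge> 2 \<and> prob_space M \<and> iid_vars M \<epsilon> {1..n} \<and>
       (\<forall>i\<in>{1..n}. sub_gaussian M K 1 (\<epsilon> i)) \<longrightarrow>
       integrable M (\<lambda>\<omega>. \<psi> (max_stat d n (\<lambda>i. \<epsilon> i \<omega>))) \<and>
       (\<integral>\<omega>. \<psi> (max_stat d n (\<lambda>i. \<epsilon> i \<omega>)) \<partial>M)
         \<le> C1 * max (\<psi> (sqrt (C2 * ln (ln (16 * real n))))) 1)"
proof -
  define b where "b = 2 * K * exp 2"
  define c where "c = 1 / (32 * b)"
  have b: "0 < b" and c: "0 < c" using assms by (auto simp: b_def c_def)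
  define J where "J \<psi> = enn2real (\<integral>\<^sup>+ t\<in>{1..}. exp (- (c / 2) * (the_inv_into {0..} \<psi> t)\<^sup>2) \<partial>lborel)" for \<psi> :: "real \<Rightarrow> real"
  have J0: "0 \<le> J \<psi>" for \<psi> by (simp add: J_def)
  have bound: "integrable M (\<lambda>\<omega>. \<psi> (max_stat d n (\<lambda>i. \<epsilon> i \<omega>))) \<and>
       (\<integral>\<omega>. \<psi> (max_stat d n (\<lambda>i. \<epsilon> i \<omega>)) \<partial>M)
         \<le> (1 + 8 * J \<psi>) * max (\<psi> (sqrt (2 / c * ln (ln (16 * real n))))) 1"
    if gf: "growth_function \<psi>" "inverse_tail_finite (c / 2) \<psi>" and n: "n \<ge> 2" and "prob_space M"
      and iid: "iid_vars M \<epsilon> {1..n}" and sg: "\<forall>i\<in>{1..n}. sub_gaussian M K 1 (\<epsilon> i)"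
    for \<psi> n and M :: "'a measure" and \<epsilon>
  proof -
    interpret prob_space M by fact
    have ind: "indep_vars (\<lambda>_. borel) \<epsilon> {1..n}" using iid by (simp add: iid_vars_def)
    then have rv: "\<epsilon> i \<in> borel_measurable M" if "i \<in> {1..n}" for i
      using that unfolding indep_vars_def2 by blast
    define a where "a = ln (16 * real n)"
    \<comment> \<open>The factor 16 makes \<open>a \<ge> 1\<close>, so that the iterated logarithm
      under the square root is nonnegative.\<close>
    have "exp 1 \<le> 16 * real n" using exp_le n by linarith
    then have a: "1 \<le> a" using n by (simp add: a_def ln_ge_iff)
    \<comment> \<open>With this \<open>r\<close> half of the exponent gives exactly
      \<open>1 / a\<close>, which cancels the logarithmic prefactor and leaves \<open>B = 8\<close>
      for every \<open>n\<close>.\<close>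
    define r where "r = sqrt (2 / c * ln a)"
    have r: "0 \<le> r" "(c / 2) * r\<^sup>2 = ln a"
      using a c by (auto simp: r_def)
    let ?Z = "\<lambda>\<omega>. max_stat d n (\<lambda>i. \<epsilon> i \<omega>)"
    have Z: "?Z \<in> borel_measurable M" using rv by (rule max_stat_measurable)
    have mgf: "(\<integral>\<^sup>+\<omega>. exp (l * \<epsilon> i \<omega>) \<partial>M) \<le> exp (b * l\<^sup>2)" if "i \<in> {1..n}" for i l
      unfolding b_def using sg that assms(2) by (intro sub_gaussian_mgf_le) auto
    have tail: "prob {\<omega>\<in>space M. y \<le> ?Z \<omega>} \<le> 8 * a * exp (- c * y\<^sup>2)" if "0 \<le> y" for y
      using max_stat_tail[OF ind mgf b that n, of d] by (simp add: a_def c_def)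
    have B: "8 * a * exp (- (c / 2) * r\<^sup>2) \<le> 8"
      using a r by (simp add: exp_minus)
    note * = expectation_growth_function_le[OF gf Z max_stat_nonneg[OF n] tail c r(1) _ B, folded J_def]
    \<comment> \<open>The maximum is at least 1, so the additive term \<open>8 * J \<psi>\<close>
      can be absorbed into the factor \<open>C1\<close>.\<close>
    have "J \<psi> \<le> J \<psi> * max (\<psi> r) 1"
      using J0 mult_left_mono[of 1 "max (\<psi> r) 1" "J \<psi>"] by simp
    then show ?thesis
      using * a unfolding r_def a_def by (simp add: algebra_simps)
  qed
  show ?thesis
  proof (intro exI conjI allI impI)
    \<comment> \<open>\<open>c0 = c / 2\<close> is the half exponent left for the integral, and
      \<open>C2 = 2 / c\<close> is the constant in \<open>r\<close>.\<close>
    show "0 < c / 2" "0 < 2 / c" using c by auto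
    show "0 < 1 + 8 * J \<psi>" for \<psi> using J0[of \<psi>] by simp
  qed (use bound in blast)+
qed

end
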